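(* If $G$ is a connected graph whose vertex set can be partitioned into $3$ cliques of sizes at least $4$ each, then $ps(G)=3$.
   Context: All graphs are finite and simple (no loops or multiple edges), without isolated vertices and without isolated edges. For an edge labelling $\omega:E(X)\to\{1,2,\ldots,s\}$ of a graph $X$, the product degree of a vertex $v$ is $pd(v)=\prod_{e\ni v}\omega(e)$, the product over all edges $e$ incident with $v$. The labelling is product-irregular if $pd(u)\neq pd(v)$ for any two distinct vertices $u,v$ of $X$ (adjacent or not). The product irregularity strength $ps(X)$ is the smallest positive integer $s$ for which there exists a product-irregular labelling $\omega:E(X)\to\{1,2,\ldots,s\}$. A clique is a set of pairwise adjacent vertices. *)

theory Defs
  imports "HOL-Library.Disjoint_Sets" "Graph_Theory.Digraph_Component"
begin

text \<open>
  A finite simple graph is a \<^locale>\<open>pair_graph\<close>: a finite, loop-free, symmetric digraph without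
  parallel arcs. An undirected edge is thus represented by two opposite arcs. Labellings assign
  one value to each undirected edge, so they are defined on the unordered pairs of end points.
\<close>

definition edges :: "'a pair_pre_digraph \<Rightarrow> 'a set set" where
  "edges G = {{u, v} | u v. (u, v) \<in> parcs G}"

locale nonisolated_graph = pair_graph G for G :: "'a pair_pre_digraph" +
  assumes no_isolated_vertex: "v \<in> pverts G \<Longrightarrow> \<exists>e \<in> edges G. v \<in> e"
    and no_isolated_edge: "e \<in> edges G \<Longrightarrow> \<exists>f \<in> edges G. f \<noteq> e \<and> e \<inter> f \<noteq> {}"

definition clique :: "'a pair_pre_digraph \<Rightarrow> 'a set \<Rightarrow> bool" where
  "clique G C \<longleftrightarrow> C \<subseteq> pverts G \<and> (\<forall>u \<in> C. \<forall>v \<in> C. u \<noteq> v \<longrightarrow> (u, v) \<in> parcs G)"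

definition edge_labelling :: "'a pair_pre_digraph \<Rightarrow> nat \<Rightarrow> ('a set \<Rightarrow> nat) \<Rightarrow> bool" where
  "edge_labelling G s \<omega> \<longleftrightarrow> (\<forall>e \<in> edges G. \<omega> e \<in> {1..s})"

definition product_degree :: "'a pair_pre_digraph \<Rightarrow> ('a set \<Rightarrow> nat) \<Rightarrow> 'a \<Rightarrow> nat" where
  "product_degree G \<omega> v = (\<Prod>e \<in> {e \<in> edges G. v \<in> e}. \<omega> e)"

definition product_irregular :: "'a pair_pre_digraph \<Rightarrow> ('a set \<Rightarrow> nat) \<Rightarrow> bool" where
  "product_irregular G \<omega> \<longleftrightarrow>
    (\<forall>u \<in> pverts G. \<forall>v \<in> pverts G. u \<noteq> v \<longrightarrow> product_degree G \<omega> u \<noteq> product_degree G \<omega> v)"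

text \<open>
  If \<open>G\<close> has no product-irregular labelling at all, \<open>LEAST\<close> yields an unspecified number; such a
  labelling exists whenever \<open>G\<close> has no isolated edge and no isolated vertex.
\<close>

definition product_irregularity_strength :: "'a pair_pre_digraph \<Rightarrow> nat" where
  "product_irregularity_strength G =
    (LEAST s. 0 < s \<and> (\<exists>\<omega>. edge_labelling G s \<omega> \<and> product_irregular G \<omega>))"

end

(*
  With labels 1, 2, 3 a product degree is 2^x * 3^y, so a labelling is product-irregular iff the points
  (x, y) of its vertices are distinct. Edges between the cliques get label 1 whenever possible, and the
  cliques then occupy disjoint sets of points. For sizes n1 <= n2 <= n3 with n2 >= 6 these
  lie along the three sides of the triangle x + y < n3; such labellings extend from a clique
  of size n to one of size n + 2 by a vertex of constant label p and one of constant label q, which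
  translates the old points. If n2 = 5, suitable labellings of the two smaller cliques have x + y <= 4
  and avoid the points of the largest one. If n1 = n2 = 4, an edge between cliques must get a label
  other than 1, and two of them if n3 = 4 as well: connectedness provides these. With labels 1 and 2 only, product-irregularity would make the vertices
  distinct in degree in the graph of edges labelled 2, which is impossible.
*)

theory Submission
  imports Defs "HOL-Library.Product_Plus"
begin

section \<open>Product degrees as points in the plane, and labelled complete graphs\<close>

definition pow23 :: "nat \<times> nat \<Rightarrow> nat" where
  "pow23 p = 2 ^ fst p * 3 ^ snd p"

lemma pow23_add: "pow23 (p + q) = pow23 p * pow23 q"
  by (simp add: pow23_def power_add)

text \<open>Powers of 2 and of 3 are coprime, so each prime power on one side divides its
  counterpart on the other and the exponents agree. Distinct points thus give distinct product
  degrees.\<close>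

lemma inj_pow23: "inj pow23"
proof (rule injI)
  fix p q assume "pow23 p = pow23 q"
  moreover obtain a b c d where "p = (a, b)" "q = (c, d)" by fastforce
  ultimately have eq: "2 ^ a * 3 ^ b = 2 ^ c * (3::nat) ^ d" by (simp add: pow23_def)
  have cop: "coprime (2 ^ i) ((3::nat) ^ j)" for i j by simp
  have "2 ^ a dvd (2::nat) ^ c" "2 ^ c dvd (2::nat) ^ a"
    using eq cop by (metis coprime_dvd_mult_left_iff dvd_triv_left)+
  moreover have "3 ^ b dvd (3::nat) ^ d" "3 ^ d dvd (3::nat) ^ b"
    using eq cop by (metis coprime_commute coprime_dvd_mult_right_iff dvd_triv_right)+
  ultimately show "p = q"
    using \<open>p = (a, b)\<close> \<open>q = (c, d)\<close>
      power_dvd_imp_le[of 2 a c] power_dvd_imp_le[of 2 c a]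
      power_dvd_imp_le[of 3 b d] power_dvd_imp_le[of 3 d b] by simp
qed

text \<open>
  The complete graph on \<open>{..<n}\<close>, where \<open>i\<close> has \<open>e i\<close> additional edges labelled 2 that leave the clique;
  \<open>d i\<close> counts the edges labelled 2 and 3 at \<open>i\<close>. The diagonal \<open>f i i = 1\<close> is a dummy that allows
  products over all of \<open>{..<n}\<close>.
\<close>

definition realises :: "nat \<Rightarrow> (nat \<Rightarrow> nat) \<Rightarrow> (nat \<times> nat) set \<Rightarrow> bool" where
  "realises n e S \<longleftrightarrow> (\<exists>f d. (\<forall>i j. f i j = f j i \<and> f i j \<in> {1..3} \<and> f i i = (1::nat)) \<and>
     inj_on d {..<n} \<and> d ` {..<n} \<subseteq> S \<and> (\<forall>i<n. 2 ^ e i * (\<Prod>j<n. f i j) = pow23 (d i)))"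

text \<open>A form of \<open>realises\<close> with explicit data that the simplifier can evaluate:
  \<open>M\<close> lists the rows of labels, \<open>D\<close> the points of the vertices. Symmetry
  is tested by comparing each column with the row of the same index.\<close>

definition table :: "nat \<Rightarrow> (nat \<Rightarrow> nat) \<Rightarrow> nat list list \<Rightarrow> (nat \<times> nat) list \<Rightarrow> bool" where
  "table n e M D \<longleftrightarrow> length M = n \<and> length D = n \<and> distinct D \<and>
     (\<forall>i \<in> set [0..<n]. length (M ! i) = n \<and> M ! i ! i = 1 \<and> set (M ! i) \<subseteq> {1, 2, 3} \<and>
       map (\<lambda>j. M ! j ! i) [0..<n] = M ! i \<and> 2 ^ e i * prod_list (M ! i) = pow23 (D ! i))"

lemma realises_table:
  assumes "table n e M D" "set D \<subseteq> S"
  shows "realises n e S"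
proof -
  \<comment> \<open>The matrix is continued by 1 beyond size \<open>n\<close>, because
    \<open>realises\<close> demands symmetry and range for all indices.\<close>
  define f where "f i j = (if i < n \<and> j < n then M ! i ! j else 1)" for i j
  have len: "length (M ! i) = n" "M ! i ! i = 1" "set (M ! i) \<subseteq> {1, 2, 3}"
      "2 ^ e i * prod_list (M ! i) = pow23 (D ! i)"
    if "i < n" for i
    using assms(1) that by (auto simp: table_def)
  have sym: "M ! i ! j = M ! j ! i" if "i < n" "j < n" for i j
  proof -
    have "map (\<lambda>j. M ! j ! i) [0..<n] = M ! i" using assms(1) that by (auto simp: table_def)
    then have "map (\<lambda>j. M ! j ! i) [0..<n] ! j = M ! i ! j" by simp
    then show ?thesis using that by simp
  qed
  have "f i j = f j i \<and> f i j \<in> {1..3} \<and> f i i = 1" for i j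
  proof (cases "i < n \<and> j < n")
    case True
    then have "M ! i ! j \<in> {1, 2, 3}" using len(1,3) by (metis nth_mem subsetD)
    then show ?thesis using True sym len(2) by (auto simp: f_def)
  qed (auto simp: f_def len(2))
  moreover have "(\<Prod>j<n. f i j) = prod_list (M ! i)" if "i < n" for i
    using that len(1) by (simp add: f_def prod.list_conv_set_nth atLeast0LessThan)
  moreover have "inj_on (\<lambda>i. D ! i) {..<n}" "(\<lambda>i. D ! i) ` {..<n} \<subseteq> S"
    using assms by (auto simp: table_def inj_on_nth)
  ultimately show ?thesis using len(4) unfolding realises_def by (metis (no_types, lifting))
qed

lemma realises_mono: "realises n e S \<Longrightarrow> S \<subseteq> T \<Longrightarrow> realises n e T"
  unfolding realises_def by (meson order_trans)

text \<open>
  Two new vertices are joined to all old ones with labels \<open>p\<close> and \<open>q\<close>, respectively, and to each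
  other with label \<open>r\<close>. This translates the old points by \<open>\<alpha>\<close>.
\<close>

lemma realises_step:
  assumes "realises n e S" "e n = 0" "e (Suc n) = 0" "{p, q, r} \<subseteq> {1..3}"
    and "p * q = pow23 \<alpha>" "p ^ n * r = pow23 \<beta>" "q ^ n * r = pow23 \<gamma>"
    and "\<beta> \<noteq> \<gamma>" "\<And>s. s \<in> S \<Longrightarrow> \<alpha> + s \<in> T - {\<beta>, \<gamma>}" "\<beta> \<in> T" "\<gamma> \<in> T"
  shows "realises (n + 2) e T"
proof -
  obtain f d where f: "\<And>i j. f i j = f j i \<and> f i j \<in> {1..3} \<and> f i i = (1::nat)"
    and d: "inj_on d {..<n}" "d ` {..<n} \<subseteq> S"
    and fd: "\<And>i. i < n \<Longrightarrow> 2 ^ e i * (\<Prod>j<n. f i j) = pow23 (d i)"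
    using assms(1) unfolding realises_def by metis
  define g where "g i j = (if i < n \<and> j < n then f i j else if i = j then 1
    else if {i, j} = {n, Suc n} then r else if i = n \<or> j = n then p else q)" for i j
  define c where "c i = (if i < n then \<alpha> + d i else if i = n then \<beta> else \<gamma>)" for i
  have split: "(\<Prod>j<n + 2. g i j) = (\<Prod>j<n. g i j) * g i n * g i (Suc n)" for i
    by simp
  have "g i j = g j i \<and> g i j \<in> {1..3} \<and> g i i = 1" for i j
    using f[of i j] f[of i i] assms(4) by (auto simp: g_def doubleton_eq_iff)
  moreover have "inj_on c {..<n + 2}"
  proof (rule inj_onI)
    fix i j assume ij: "i \<in> {..<n + 2}" "j \<in> {..<n + 2}" "c i = c j"
    have "\<alpha> + d k \<noteq> \<beta> \<and> \<alpha> + d k \<noteq> \<gamma>" if "k < n" for k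
      using assms(9)[of "d k"] d(2) that by auto
    moreover have "i = j" if "i < n" "j < n"
      using inj_onD[OF d(1), of i j] that ij(3) by (simp add: c_def)
    ultimately show "i = j"
      using ij assms(8) by (auto simp: c_def less_Suc_eq split: if_splits)
  qed
  moreover have "c ` {..<n + 2} \<subseteq> T"
  proof (rule image_subsetI)
    fix i assume "i \<in> {..<n + 2}"
    then show "c i \<in> T"
      using assms(9)[of "d i"] assms(10,11) d(2) by (auto simp: c_def)
  qed
  moreover have "2 ^ e i * (\<Prod>j<n + 2. g i j) = pow23 (c i)" if i: "i < n + 2" for i
  proof -
    consider "i < n" | "i = n" | "i = Suc n" using i by linarith
    then show ?thesis
    proof cases
      case 1
      then have "(\<Prod>j<n. g i j) = (\<Prod>j<n. f i j)" by (simp add: g_def)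
      then have "2 ^ e i * (\<Prod>j<n + 2. g i j) = pow23 (d i) * (p * q)"
        using 1 unfolding split fd[OF 1, symmetric] by (simp add: g_def doubleton_eq_iff)
      then show ?thesis using 1 assms(5) by (simp add: c_def pow23_add)
    next
      case 2
      then have "(\<Prod>j<n. g i j) = p ^ n" by (simp add: g_def doubleton_eq_iff)
      then show ?thesis using 2 assms(2,6) unfolding split by (simp add: c_def g_def)
    next
      case 3
      then have "(\<Prod>j<n. g i j) = q ^ n" by (simp add: g_def doubleton_eq_iff)
      then show ?thesis using 3 assms(3,7) unfolding split by (simp add: c_def g_def insert_commute)
    qed
  qed
  ultimately show ?thesis unfolding realises_def by blast
qed

section \<open>Gluing labelled cliques\<close>

text \<open>The analogue of \<open>realises\<close> on a set of vertices, free of any numbering. In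
  the gluing, \<open>\<epsilon> v\<close> is the number of edges labelled 2 that leave the clique at
  \<open>v\<close>.\<close>

definition block :: "'a set \<Rightarrow> ('a \<Rightarrow> nat) \<Rightarrow> (nat \<times> nat) set \<Rightarrow> bool" where
  "block K \<epsilon> S \<longleftrightarrow> (\<exists>f d. (\<forall>u v. f u v = f v u \<and> f u v \<in> {1..3} \<and> f u u = (1::nat)) \<and>
     inj_on d K \<and> d ` K \<subseteq> S \<and> (\<forall>v\<in>K. 2 ^ \<epsilon> v * (\<Prod>u\<in>K. f v u) = pow23 (d v)))"

lemma block_if_realises:
  assumes "realises n e S" "bij_betw h K {..<n}" "\<And>v. v \<in> K \<Longrightarrow> \<epsilon> v = e (h v)"
  shows "block K \<epsilon> S"
proof -
  obtain f d where f: "\<And>i j. f i j = f j i \<and> f i j \<in> {1..3} \<and> f i i = (1::nat)"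
    and d: "inj_on d {..<n}" "d ` {..<n} \<subseteq> S"
    and fd: "\<And>i. i < n \<Longrightarrow> 2 ^ e i * (\<Prod>j<n. f i j) = pow23 (d i)"
    using assms(1) unfolding realises_def by metis
  have h: "inj_on h K" "h ` K = {..<n}" using assms(2) by (auto simp: bij_betw_def)
  have "inj_on (d \<circ> h) K" "(d \<circ> h) ` K \<subseteq> S" using h d by (auto intro: comp_inj_on)
  moreover have "2 ^ \<epsilon> v * (\<Prod>u\<in>K. f (h v) (h u)) = pow23 ((d \<circ> h) v)" if "v \<in> K" for v
  proof -
    have "(\<Prod>u\<in>K. f (h v) (h u)) = (\<Prod>j<n. f (h v) j)"
      by (rule prod.reindex_bij_betw[OF assms(2)])
    then show ?thesis using fd[of "h v"] assms(3) that h by auto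
  qed
  ultimately show ?thesis unfolding block_def
    by (intro exI[of _ "\<lambda>u v. f (h u) (h v)"] exI[of _ "d \<circ> h"]) (use f in auto)
qed

text \<open>Labellings live on unordered pairs, while the gluing defines labels on ordered ones. A
  doubleton determines its end points up to order, so symmetry makes the value unique.\<close>

lemma ex_doubleton_fun:
  assumes "\<And>u v. f u v = f v u"
  shows "\<exists>\<omega>. \<forall>u v. \<omega> {u, v} = f u v"
proof -
  have "(THE x. \<exists>a b. {u, v} = {a, b} \<and> x = f a b) = f u v" for u v
    using assms by (intro the_equality) (auto simp: doubleton_eq_iff)
  then show ?thesis by (intro exI[of _ "\<lambda>e. THE x. \<exists>a b. e = {a, b} \<and> x = f a b"]) blast
qed

lemma (in pair_graph) parcsD:
  "(u, v) \<in> parcs G \<Longrightarrow> u \<in> pverts G \<and> v \<in> pverts G \<and> u \<noteq> v \<and> (v, u) \<in> parcs G"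
  using arc_fst_in_verts arc_snd_in_verts no_loops arcs_symmetric by (metis fst_conv snd_conv)

lemma (in pair_graph) doubleton_in_edges: "{u, v} \<in> edges G \<longleftrightarrow> (u, v) \<in> parcs G"
  using parcsD by (auto simp: edges_def doubleton_eq_iff)

lemma (in pair_graph) edge_at:
  assumes "e \<in> edges G" "v \<in> e"
  obtains u where "u \<in> pverts G" "e = {v, u}"
proof -
  obtain a b where "e = {a, b}" "(a, b) \<in> parcs G" using assms(1) unfolding edges_def by blast
  then show thesis using that[of a] that[of b] assms(2) parcsD[of a b] by (auto simp: insert_commute)
qed

lemma (in pair_graph) edges_at:
  "{e \<in> edges G. v \<in> e} = (\<lambda>u. {v, u}) ` {u \<in> pverts G. {v, u} \<in> edges G}"
proof (intro equalityI subsetI)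
  fix e assume "e \<in> {e \<in> edges G. v \<in> e}"
  then show "e \<in> (\<lambda>u. {v, u}) ` {u \<in> pverts G. {v, u} \<in> edges G}"
    by (blast elim: edge_at)
qed blast

text \<open>Edges at \<open>v\<close> correspond to neighbours of \<open>v\<close>. A product over
  vertices can be split along the cliques.\<close>

lemma (in pair_graph) product_degree_eq:
  "product_degree G \<omega> v = (\<Prod>u \<in> {u \<in> pverts G. {v, u} \<in> edges G}. \<omega> {v, u})"
proof -
  have "inj_on (\<lambda>u. {v, u}) A" for A by (auto simp: inj_on_def doubleton_eq_iff)
  then show ?thesis unfolding product_degree_def edges_at by (simp add: prod.reindex)
qed

text \<open>Edges inside a clique take the labels of its block, edges in \<open>E\<close> the label
  2, all others the label 1. Each vertex then has the point assigned by its block, and disjoint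
  regions separate vertices of different cliques.\<close>

lemma (in pair_graph) ex_labelling_if_blocks:
  assumes P: "partition_on (pverts G) P" "\<And>K. K \<in> P \<Longrightarrow> clique G K"
    and E: "E \<subseteq> edges G" "\<And>e K. e \<in> E \<Longrightarrow> K \<in> P \<Longrightarrow> \<not> e \<subseteq> K"
    and block: "\<And>K. K \<in> P \<Longrightarrow> block K (\<lambda>v. card {e \<in> E. v \<in> e}) (S K)"
    and disj: "\<And>K L. K \<in> P \<Longrightarrow> L \<in> P \<Longrightarrow> K \<noteq> L \<Longrightarrow> S K \<inter> S L = {}"
  shows "\<exists>\<omega>. edge_labelling G 3 \<omega> \<and> product_irregular G \<omega>"
proof -
  define Q where "Q K f d \<longleftrightarrow> (\<forall>u v. f u v = f v u \<and> f u v \<in> {1..3} \<and> f u u = (1::nat)) \<and>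
    inj_on d K \<and> d ` K \<subseteq> S K \<and> (\<forall>v\<in>K. 2 ^ card {e \<in> E. v \<in> e} * (\<Prod>u\<in>K. f v u) = pow23 (d v))"
    for K f d
  have "\<forall>K\<in>P. \<exists>f d. Q K f d"
    using block unfolding block_def Q_def by blast
  then obtain f d where Q: "\<And>K. K \<in> P \<Longrightarrow> Q K (f K) (d K)" by metis
  have f: "f K u v = f K v u \<and> f K u v \<in> {1..3} \<and> f K u u = 1" if "K \<in> P" for K u v
    using Q[OF that] unfolding Q_def by blast
  have d: "inj_on (d K) K \<and> d K ` K \<subseteq> S K" if "K \<in> P" for K
    using Q[OF that] unfolding Q_def by blast
  have fd: "2 ^ card {e \<in> E. v \<in> e} * (\<Prod>u\<in>K. f K v u) = pow23 (d K v)" if "K \<in> P" "v \<in> K" for K v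
    using Q[OF that(1)] that(2) unfolding Q_def by blast
  have "\<forall>v. \<exists>K. v \<in> pverts G \<longrightarrow> v \<in> K \<and> K \<in> P"
    using P(1) by (auto simp: partition_on_def)
  then obtain k where k: "\<And>v. v \<in> pverts G \<Longrightarrow> v \<in> k v \<and> k v \<in> P" by metis
  have k_eq: "k v = K" if "v \<in> K" "K \<in> P" for v K
    using P(1) that k[of v] by (auto simp: partition_on_def disjoint_def)
  have PV: "K \<subseteq> pverts G" if "K \<in> P" for K
    using P(1) that by (auto simp: partition_on_def)
  define g where "g u v = (if \<exists>K\<in>P. u \<in> K \<and> v \<in> K then f (k u) u v
    else if {u, v} \<in> E then 2 else 1)" for u v
  have g_in: "g u v = f K u v" if "u \<in> K" "v \<in> K" "K \<in> P" for u v K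
    using that k_eq by (auto simp: g_def)
  have "g u v = g v u" for u v
  proof (cases "\<exists>K\<in>P. u \<in> K \<and> v \<in> K")
    case True
    then obtain K where "K \<in> P" "u \<in> K" "v \<in> K" by blast
    then show ?thesis using g_in[of u K v] g_in[of v K u] f[of K u v] by simp
  next
    case False
    then have "\<not> (\<exists>K\<in>P. v \<in> K \<and> u \<in> K)" by blast
    then show ?thesis using False unfolding g_def insert_commute[of u v] by presburger
  qed
  then obtain \<omega> where \<omega>: "\<And>u v. \<omega> {u, v} = g u v"
    using ex_doubleton_fun[of g] by blast
  have pd: "product_degree G \<omega> v = pow23 (d K v)" if v: "v \<in> K" and K: "K \<in> P" for v K
  proof -
    have out: "g v u = (if {v, u} \<in> E then 2 else 1)" if "u \<notin> K" for u
      using that k_eq[of v] v K by (auto simp: g_def)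
    \<comment> \<open>Non-neighbours contribute 1: within the clique the only one is
      \<open>v\<close> itself, with its dummy label, and outside it no pair in \<open>E\<close> is
      involved.\<close>
    have "product_degree G \<omega> v = (\<Prod>u\<in>pverts G. g v u)"
      unfolding product_degree_eq \<omega>
    proof (rule prod.mono_neutral_left)
      show "\<forall>u\<in>pverts G - {u \<in> pverts G. {v, u} \<in> edges G}. g v u = 1"
      proof
        fix u assume u: "u \<in> pverts G - {u \<in> pverts G. {v, u} \<in> edges G}"
        then show "g v u = 1"
        proof (cases "u \<in> K")
          case True
          have "u = v"
            using u P(2)[OF K] True v doubleton_in_edges unfolding clique_def by auto
          then show ?thesis using g_in[OF v v K] f[OF K] by simp
        next
          case False
          then show ?thesis using out[of u] u E(1) by auto
        qed
      qed
    qed (auto simp: pair_finite_verts)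
    also have "\<dots> = (\<Prod>u\<in>K. g v u) * (\<Prod>u\<in>pverts G - K. g v u)"
      using PV[OF K] pair_finite_verts by (metis mult.commute prod.subset_diff)
    also have "(\<Prod>u\<in>K. g v u) = (\<Prod>u\<in>K. f K v u)"
      using g_in v K by (intro prod.cong) auto
    also have "(\<Prod>u\<in>pverts G - K. g v u) = (\<Prod>u\<in>pverts G - K. if {v, u} \<in> E then 2 else 1)"
      using out by (intro prod.cong) auto
    also have "\<dots> = 2 ^ card {u \<in> pverts G - K. {v, u} \<in> E}"
      using pair_finite_verts by (subst prod.inter_filter[symmetric]) auto
    \<comment> \<open>No edge of \<open>E\<close> lies inside \<open>K\<close>, so an edge of
      \<open>E\<close> at \<open>v\<close> has its other end point outside \<open>K\<close>.\<close>
    also have "card {u \<in> pverts G - K. {v, u} \<in> E} = card {e \<in> E. v \<in> e}"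
    proof (rule bij_betw_same_card[of "\<lambda>u. {v, u}"], unfold bij_betw_def, intro conjI)
      show "inj_on (\<lambda>u. {v, u}) {u \<in> pverts G - K. {v, u} \<in> E}"
        by (auto simp: inj_on_def doubleton_eq_iff)
      have "e \<in> (\<lambda>u. {v, u}) ` {u \<in> pverts G - K. {v, u} \<in> E}" if e: "e \<in> E" "v \<in> e" for e
      proof -
        obtain u where u: "u \<in> pverts G" "e = {v, u}"
          using edge_at[of e v] e E(1) by blast
        then have "u \<notin> K" using E(2)[OF e(1) K] v by auto
        then show ?thesis using u e by auto
      qed
      then show "(\<lambda>u. {v, u}) ` {u \<in> pverts G - K. {v, u} \<in> E} = {e \<in> E. v \<in> e}"
        by auto
    qed
    finally show ?thesis using fd[OF K v] by (simp add: mult.commute)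
  qed
  have "product_irregular G \<omega>"
    unfolding product_irregular_def
  proof (intro ballI impI)
    fix u v assume uv: "u \<in> pverts G" "v \<in> pverts G" "u \<noteq> v"
    have "d (k u) u \<noteq> d (k v) v"
    proof (cases "k u = k v")
      case True
      then show ?thesis using d[of "k v"] k[OF uv(1)] k[OF uv(2)] uv(3) by (auto dest: inj_onD)
    next
      case False
      then have "S (k u) \<inter> S (k v) = {}" using disj k uv by blast
      moreover have "d (k u) u \<in> S (k u)" "d (k v) v \<in> S (k v)" using d k uv by blast+
      ultimately show ?thesis by auto
    qed
    then show "product_degree G \<omega> u \<noteq> product_degree G \<omega> v"
      using pd k uv injD[OF inj_pow23] by metis
  qed
  moreover have "edge_labelling G 3 \<omega>"
    unfolding edge_labelling_def
  proof
    fix e assume "e \<in> edges G"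
    then obtain u v where e: "e = {u, v}" "(u, v) \<in> parcs G" by (auto simp: edges_def)
    have "f (k u) u v \<in> {1..3}" using f[of "k u" u v] k[of u] parcsD[OF e(2)] by blast
    then show "\<omega> e \<in> {1..3}" unfolding e(1) \<omega> by (auto simp: g_def)
  qed
  ultimately show ?thesis by blast
qed

section \<open>Families of labelled cliques\<close>

text \<open>
  The three regions run along the sides of the triangle \<open>x + y < n\<close> and are disjoint when the sizes
  increase from \<open>near_x_axis\<close> to \<open>near_antidiagonal\<close> and are at least 4, 6 and 6. An antiregular graph
  realises one side except for its two vertices of equal degree; these are separated by points next
  to that side.
  The bound \<open>x + y \<le> n\<close> rather than \<open>x + y < n\<close> leaves room for one edge leaving the largest clique.
\<close>

definition near_x_axis :: "nat \<Rightarrow> (nat \<times> nat) set" where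
  "near_x_axis n = {(x, y). y = 0 \<and> x + 2 \<le> n \<or> y = 1 \<and> 1 \<le> x \<and> x + 1 \<le> max 3 (n - 3)}"

definition near_y_axis :: "nat \<Rightarrow> (nat \<times> nat) set" where
  "near_y_axis n = {(x, y). x = 0 \<and> 1 \<le> y \<and> y < n \<or> x = 1 \<and> 2 \<le> y \<and> y + 3 \<le> n}"

definition near_antidiagonal :: "nat \<Rightarrow> (nat \<times> nat) set" where
  "near_antidiagonal n = {(x, y). 1 \<le> x \<and> n \<le> x + y + 2 \<and> x + y \<le> n \<and> (x + y + 2 = n \<longrightarrow> 2 \<le> x \<and> 1 \<le> y)}"

lemma realises_near_x_axis_4: "realises 4 (\<lambda>_. 0) (near_x_axis 4)"
  by (rule realises_table[of _ _
      "[[1, 1, 1, 2],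
      [1, 1, 2, 2],
      [1, 2, 1, 3],
      [2, 2, 3, 1]]"
      "[(1, 0), (2, 0), (1, 1), (2, 1)]"])
    (simp_all add: table_def pow23_def upt_rec near_x_axis_def)

lemma realises_near_x_axis_5: "realises 5 (\<lambda>_. 0) (near_x_axis 5)"
  by (rule realises_table[of _ _
      "[[1, 1, 1, 1, 1],
      [1, 1, 1, 1, 2],
      [1, 1, 1, 2, 2],
      [1, 1, 2, 1, 3],
      [1, 2, 2, 3, 1]]"
      "[(0, 0), (1, 0), (2, 0), (1, 1), (2, 1)]"])
    (simp_all add: table_def pow23_def upt_rec near_x_axis_def)

lemma realises_near_x_axis_6: "realises 6 (\<lambda>_. 0) (near_x_axis 6)"
  by (rule realises_table[of _ _
      "[[1, 1, 3, 2, 1, 2],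
      [1, 1, 1, 2, 1, 2],
      [3, 1, 1, 1, 1, 2],
      [2, 2, 1, 1, 1, 2],
      [1, 1, 1, 1, 1, 1],
      [2, 2, 2, 2, 1, 1]]"
      "[(2, 1), (2, 0), (1, 1), (3, 0), (0, 0), (4, 0)]"])
    (simp_all add: table_def pow23_def upt_rec near_x_axis_def)

lemma realises_near_y_axis_6: "realises 6 (\<lambda>_. 0) (near_y_axis 6)"
  by (rule realises_table[of _ _
      "[[1, 3, 1, 3, 1, 3],
      [3, 1, 2, 3, 1, 3],
      [1, 2, 1, 3, 1, 3],
      [3, 3, 3, 1, 1, 3],
      [1, 1, 1, 1, 1, 3],
      [3, 3, 3, 3, 3, 1]]"
      "[(0, 3), (1, 3), (1, 2), (0, 4), (0, 1), (0, 5)]"])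
    (simp_all add: table_def pow23_def upt_rec near_y_axis_def)

lemma realises_near_y_axis_7: "realises 7 (\<lambda>_. 0) (near_y_axis 7)"
  by (rule realises_table[of _ _
      "[[1, 1, 1, 1, 3, 3, 1],
      [1, 1, 1, 3, 1, 3, 3],
      [1, 1, 1, 1, 3, 1, 1],
      [1, 3, 1, 1, 2, 3, 3],
      [3, 1, 3, 2, 1, 3, 3],
      [3, 3, 1, 3, 3, 1, 3],
      [1, 3, 1, 3, 3, 3, 1]]"
      "[(0, 2), (0, 3), (0, 1), (1, 3), (1, 4), (0, 5), (0, 4)]"])
    (simp_all add: table_def pow23_def upt_rec near_y_axis_def)

lemma realises_near_antidiagonal_6: "realises 6 (\<lambda>_. 0) (near_antidiagonal 6)"
  by (rule realises_table[of _ _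
      "[[1, 3, 3, 3, 3, 2],
      [3, 1, 1, 2, 2, 2],
      [3, 1, 1, 3, 2, 2],
      [3, 2, 3, 1, 2, 2],
      [3, 2, 2, 2, 1, 2],
      [2, 2, 2, 2, 2, 1]]"
      "[(1, 4), (3, 1), (2, 2), (3, 2), (4, 1), (5, 0)]"])
    (simp_all add: table_def pow23_def upt_rec near_antidiagonal_def)

lemma realises_near_antidiagonal_7: "realises 7 (\<lambda>_. 0) (near_antidiagonal 7)"
  by (rule realises_table[of _ _
      "[[1, 2, 2, 3, 3, 3, 2],
      [2, 1, 2, 2, 2, 2, 2],
      [2, 2, 1, 1, 3, 2, 2],
      [3, 2, 1, 1, 3, 2, 2],
      [3, 2, 3, 3, 1, 3, 3],
      [3, 2, 2, 2, 3, 1, 2],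
      [2, 2, 2, 2, 3, 2, 1]]"
      "[(3, 3), (6, 0), (4, 1), (3, 2), (1, 5), (4, 2), (5, 1)]"])
    (simp_all add: table_def pow23_def upt_rec near_antidiagonal_def)

text \<open>The labels are those of \<open>realises_near_antidiagonal_6\<close>. The edge leaving at
  vertex 0 moves its point from \<open>(1, 4)\<close> to \<open>(2, 4)\<close>, onto the line
  \<open>x + y = n\<close>, which no other vertex uses. Size 7 is alike, with \<open>(3, 3)\<close>
  moved to \<open>(4, 3)\<close>.\<close>

lemma realises_near_antidiagonal_6_one: "realises 6 (\<lambda>i. if i = 0 then 1 else 0) (near_antidiagonal 6)"
  by (rule realises_table[of _ _
      "[[1, 3, 3, 3, 3, 2],
      [3, 1, 1, 2, 2, 2],
      [3, 1, 1, 3, 2, 2],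
      [3, 2, 3, 1, 2, 2],
      [3, 2, 2, 2, 1, 2],
      [2, 2, 2, 2, 2, 1]]"
      "[(2, 4), (3, 1), (2, 2), (3, 2), (4, 1), (5, 0)]"])
    (simp_all add: table_def pow23_def upt_rec near_antidiagonal_def)

lemma realises_near_antidiagonal_7_one: "realises 7 (\<lambda>i. if i = 0 then 1 else 0) (near_antidiagonal 7)"
  by (rule realises_table[of _ _
      "[[1, 2, 2, 3, 3, 3, 2],
      [2, 1, 2, 2, 2, 2, 2],
      [2, 2, 1, 1, 3, 2, 2],
      [3, 2, 1, 1, 3, 2, 2],
      [3, 2, 3, 3, 1, 3, 3],
      [3, 2, 2, 2, 3, 1, 2],
      [2, 2, 2, 2, 3, 2, 1]]"
      "[(4, 3), (6, 0), (4, 1), (3, 2), (1, 5), (4, 2), (5, 1)]"])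
    (simp_all add: table_def pow23_def upt_rec near_antidiagonal_def)

text \<open>Fits \<open>realises_step\<close>, which adds two vertices. Carrying \<open>P n\<close>
  and \<open>P (Suc n)\<close> together reduces it to ordinary induction.\<close>

lemma two_step_induct [consumes 1, case_names base Suc_base step]:
  fixes n m :: nat
  assumes "m \<le> n" "P m" "P (Suc m)" "\<And>k. m \<le> k \<Longrightarrow> P k \<Longrightarrow> P (k + 2)"
  shows "P n"
proof -
  have "P n \<and> P (Suc n)" using assms(1)
    by (induction rule: dec_induct) (use assms in auto)
  then show ?thesis ..
qed

lemma realises_near_x_axis:
  assumes "4 \<le> n"
  shows "realises n (\<lambda>_. 0) (near_x_axis n)"
\<comment> \<open>The step by two would carry \<open>(2, 1)\<close> at size 4 to
  \<open>(3, 1)\<close>, outside the region for size 6. Hence the induction starts at 5.\<close>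
proof (cases "n = 4")
  case True
  then show ?thesis using realises_near_x_axis_4 by simp
next
  case False
  then have "5 \<le> n" using assms by simp
  then show ?thesis
  proof (induction rule: two_step_induct)
    case (step k)
    then show ?case
      \<comment> \<open>The row of points moves one to the right, and the new vertices take its two
        ends.\<close>
      by (intro realises_step[of k _ "near_x_axis k" 1 2 1 "(1, 0)" "(0, 0)" "(k, 0)"])
        (auto simp: pow23_def near_x_axis_def)
  qed (use realises_near_x_axis_5 realises_near_x_axis_6 in simp_all)
qed

lemma realises_near_y_axis:
  assumes "6 \<le> n"
  shows "realises n (\<lambda>_. 0) (near_y_axis n)"
  using assms
proof (induction rule: two_step_induct)
  case (step k)
  then show ?case
    \<comment> \<open>Label 3 between the new vertices puts the one with labels 1 at
      \<open>(0, 1)\<close> instead of the origin, which belongs to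
      \<open>near_x_axis\<close>.\<close>
    by (intro realises_step[of k _ "near_y_axis k" 1 3 3 "(0, 1)" "(0, 1)" "(0, k + 1)"])
      (auto simp: pow23_def near_y_axis_def zero_prod_def)
qed (use realises_near_y_axis_6 realises_near_y_axis_7 in simp_all)

lemma realises_near_antidiagonal:
  assumes "6 \<le> n" "e = (\<lambda>_. 0) \<or> e = (\<lambda>i. if i = 0 then 1 else 0)"
  shows "realises n e (near_antidiagonal n)"
  using assms(1)
proof (induction rule: two_step_induct)
  case (step k)
  then show ?case
    \<comment> \<open>Label 2 between the new vertices puts the one with labels 3 at
      \<open>(1, k)\<close> instead of \<open>(0, k + 1)\<close>, which lies on the y-axis.\<close>
    by (intro realises_step[of k _ "near_antidiagonal k" 2 3 2 "(1, 1)" "(k + 1, 0)" "(1, k)"])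
      (use assms(2) in \<open>auto simp: pow23_def near_antidiagonal_def\<close>)
qed (use assms(2) realises_near_antidiagonal_6 realises_near_antidiagonal_7
    realises_near_antidiagonal_6_one realises_near_antidiagonal_7_one in auto)

section \<open>Three cliques with at most two edges between them labelled 2\<close>

definition three_cliques :: "'a pair_pre_digraph \<Rightarrow> 'a set \<Rightarrow> 'a set \<Rightarrow> 'a set \<Rightarrow> bool" where
  "three_cliques G A B C \<longleftrightarrow> partition_on (pverts G) {A, B, C} \<and> A \<noteq> B \<and> A \<noteq> C \<and> B \<noteq> C \<and>
     clique G A \<and> clique G B \<and> clique G C"

lemma three_cliques_commute:
  "three_cliques G A B C \<Longrightarrow> three_cliques G B A C"
  "three_cliques G A B C \<Longrightarrow> three_cliques G A C B"
  unfolding three_cliques_def by (auto simp: insert_commute)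

lemma three_cliques_disjoint:
  assumes "three_cliques G A B C"
  shows "A \<inter> B = {}" "A \<inter> C = {}" "B \<inter> C = {}" "A \<union> B \<union> C = pverts G"
  using assms by (auto simp: three_cliques_def partition_on_def disjoint_def)

lemma block_const:
  assumes "realises (card K) (\<lambda>_. 0) S" "finite K" "\<And>v. v \<in> K \<Longrightarrow> \<epsilon> v = 0"
  shows "block K \<epsilon> S"
proof -
  obtain h where "bij_betw h K {..<card K}"
    using assms(2) ex_bij_betw_finite_nat by (metis atLeast0LessThan)
  then show ?thesis by (rule block_if_realises[OF assms(1)]) (simp add: assms(3))
qed

text \<open>The clique is numbered so that \<open>a\<close> and \<open>b\<close> become 0 and 1, the
  only indices where \<open>e\<close> may be nonzero.\<close>

lemma block_at_two:
  assumes "realises (card K) e S" "finite K" "a \<in> K" "b \<in> K" "a \<noteq> b"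
    and "\<epsilon> a = e 0" "\<epsilon> b = e 1" "\<And>v. v \<in> K - {a, b} \<Longrightarrow> \<epsilon> v = 0" "\<And>i. 2 \<le> i \<Longrightarrow> e i = 0"
  shows "block K \<epsilon> S"
proof -
  have c: "card K = Suc (Suc (card (K - {a, b})))"
    using assms(2-5) card_Diff_subset[of "{a, b}" K] card_mono[of K "{a, b}"] by simp
  then have "card (K - {a, b}) = card {2..<card K}" by simp
  then obtain g where g: "bij_betw g (K - {a, b}) {2..<card K}"
    using assms(2) finite_same_card_bij by (metis finite_Diff finite_atLeastLessThan)
  define h where "h = g(a := 0, b := 1)"
  have "bij_betw h (K - {a, b}) {2..<card K}"
    using g by (subst bij_betw_cong[of _ h g]) (auto simp: h_def)
  moreover have "bij_betw h {a, b} {0, 1}"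
    using assms(5) by (auto simp: h_def bij_betw_def)
  ultimately have "bij_betw h ((K - {a, b}) \<union> {a, b}) ({2..<card K} \<union> {0, 1})"
    by (rule bij_betw_combine) auto
  moreover have "(K - {a, b}) \<union> {a, b} = K" "{2..<card K} \<union> {0, 1} = {..<card K}"
    using assms(3,4) c by auto
  ultimately have h: "bij_betw h K {..<card K}" by simp
  show ?thesis
  proof (rule block_if_realises[OF assms(1) h])
    fix v assume v: "v \<in> K"
    have "2 \<le> g v" if "v \<notin> {a, b}" using g v that by (auto simp: bij_betw_def)
    then show "\<epsilon> v = e (h v)"
      using assms(5-9) v by (cases "v \<in> {a, b}") (auto simp: h_def)
  qed
qed

lemma block_at_one:
  assumes "realises (card K) (\<lambda>i. if i = 0 then k else 0) S" "2 \<le> card K" "a \<in> K"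
    and "\<epsilon> a = k" "\<And>v. v \<in> K - {a} \<Longrightarrow> \<epsilon> v = 0"
  shows "block K \<epsilon> S"
proof -
  have fin: "finite K" using assms(2) by (metis card.infinite not_numeral_le_zero)
  moreover obtain b where "b \<in> K" "b \<noteq> a"
    using assms(2,3) fin by (metis card_le_Suc0_iff_eq not_less_eq_eq numeral_2_eq_2)
  ultimately show ?thesis
    using assms by (intro block_at_two[of K "\<lambda>i. if i = 0 then k else 0" S a b]) auto
qed

lemma (in pair_graph) ex_labelling_if_three_blocks:
  assumes "three_cliques G A B C" "E \<subseteq> edges G"
    and "\<And>e. e \<in> E \<Longrightarrow> \<not> e \<subseteq> A \<and> \<not> e \<subseteq> B \<and> \<not> e \<subseteq> C"
    and "block A (\<lambda>v. card {e \<in> E. v \<in> e}) SA" "block B (\<lambda>v. card {e \<in> E. v \<in> e}) SB"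
      "block C (\<lambda>v. card {e \<in> E. v \<in> e}) SC"
    and "SA \<inter> SB = {}" "SA \<inter> SC = {}" "SB \<inter> SC = {}"
  shows "\<exists>\<omega>. edge_labelling G 3 \<omega> \<and> product_irregular G \<omega>"
proof (rule ex_labelling_if_blocks)
  let ?S = "\<lambda>K. if K = A then SA else if K = B then SB else SC"
  note ABC = assms(1)[unfolded three_cliques_def]
  have neq: "A \<noteq> B" "B \<noteq> A" "A \<noteq> C" "C \<noteq> A" "B \<noteq> C" "C \<noteq> B" using ABC by blast+
  show "partition_on (pverts G) {A, B, C}" using ABC by blast
  show "clique G K" if "K \<in> {A, B, C}" for K using ABC that by blast
  show "\<not> e \<subseteq> K" if "e \<in> E" "K \<in> {A, B, C}" for e K using assms(3) that by blast
  show "block K (\<lambda>v. card {e \<in> E. v \<in> e}) (?S K)" if "K \<in> {A, B, C}" for K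
    using assms(4-6) neq that by (elim insertE) simp_all
  show "?S K \<inter> ?S L = {}" if "K \<in> {A, B, C}" "L \<in> {A, B, C}" "K \<noteq> L" for K L
    using assms(7-9) neq that by (elim insertE) (simp_all add: Int_commute)
qed (rule assms(2))

lemma (in pair_graph) ex_labelling_no_edge:
  assumes "three_cliques G A B C"
    and "realises (card A) (\<lambda>_. 0) SA" "realises (card B) (\<lambda>_. 0) SB" "realises (card C) (\<lambda>_. 0) SC"
    and "SA \<inter> SB = {}" "SA \<inter> SC = {}" "SB \<inter> SC = {}"
  shows "\<exists>\<omega>. edge_labelling G 3 \<omega> \<and> product_irregular G \<omega>"
proof -
  have "finite A" "finite B" "finite C"
    using three_cliques_disjoint(4)[OF assms(1)] pair_finite_verts by (metis finite_Un)+
  then show ?thesis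
    using assms by (intro ex_labelling_if_three_blocks[of A B C "{}" SA SB SC]) (auto intro!: block_const)
qed

lemma card_pairs_at:
  "card {e \<in> {p}. v \<in> e} = (if v \<in> p then 1 else 0)"
  "p \<noteq> q \<Longrightarrow> card {e \<in> {p, q}. v \<in> e} = (if v \<in> p then 1 else 0) + (if v \<in> q then 1 else 0)"
proof -
  show "card {e \<in> {p}. v \<in> e} = (if v \<in> p then 1 else 0)"
    by (cases "v \<in> p") (simp_all add: Collect_conv_if)
  have "{e \<in> {p, q}. v \<in> e} = (if v \<in> p then {p} else {}) \<union> (if v \<in> q then {q} else {})" by auto
  then show "p \<noteq> q \<Longrightarrow> card {e \<in> {p, q}. v \<in> e} = (if v \<in> p then 1 else 0) + (if v \<in> q then 1 else 0)"
    by simp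
qed

lemma (in pair_graph) ex_labelling_one_edge:
  assumes "three_cliques G A B C" "a \<in> A" "b \<in> B" "(a, b) \<in> parcs G" "2 \<le> card A" "2 \<le> card B"
    and "realises (card A) (\<lambda>i. if i = 0 then 1 else 0) SA"
      "realises (card B) (\<lambda>i. if i = 0 then 1 else 0) SB" "realises (card C) (\<lambda>_. 0) SC"
    and "SA \<inter> SB = {}" "SA \<inter> SC = {}" "SB \<inter> SC = {}"
  shows "\<exists>\<omega>. edge_labelling G 3 \<omega> \<and> product_irregular G \<omega>"
proof -
  note disj = three_cliques_disjoint[OF assms(1)]
  have C: "finite C" using disj(4) pair_finite_verts by (metis finite_Un)
  have notin: "a \<notin> B" "a \<notin> C" "b \<notin> A" "b \<notin> C" using disj assms(2,3) by auto
  show ?thesis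
  proof (rule ex_labelling_if_three_blocks[of A B C "{{a, b}}" SA SB SC])
    show "block A (\<lambda>v. card {e \<in> {{a, b}}. v \<in> e}) SA"
      by (rule block_at_one[OF assms(7,5,2)], unfold card_pairs_at) (use notin in auto)
    show "block B (\<lambda>v. card {e \<in> {{a, b}}. v \<in> e}) SB"
      by (rule block_at_one[OF assms(8,6,3)], unfold card_pairs_at) (use notin in auto)
    show "block C (\<lambda>v. card {e \<in> {{a, b}}. v \<in> e}) SC"
      by (rule block_const[OF assms(9) C], unfold card_pairs_at) (use notin in auto)
  qed (use assms notin doubleton_in_edges in auto)
qed

text \<open>\<open>B\<close> is the middle of a path of cliques. The two edges may or may not meet
  in \<open>B\<close>, so \<open>B\<close> needs a realisation for either case, within the same
  region \<open>SB\<close>.\<close>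

lemma (in pair_graph) ex_labelling_two_edges:
  assumes "three_cliques G A B C" "a \<in> A" "b \<in> B" "b' \<in> B" "c \<in> C"
    and "(a, b) \<in> parcs G" "(c, b') \<in> parcs G" "2 \<le> card A" "2 \<le> card B" "2 \<le> card C"
    and "realises (card A) (\<lambda>i. if i = 0 then 1 else 0) SA"
      "realises (card C) (\<lambda>i. if i = 0 then 1 else 0) SC"
      "realises (card B) (\<lambda>i. if i < 2 then 1 else 0) SB"
      "realises (card B) (\<lambda>i. if i = 0 then 2 else 0) SB"
    and "SA \<inter> SB = {}" "SA \<inter> SC = {}" "SB \<inter> SC = {}"
  shows "\<exists>\<omega>. edge_labelling G 3 \<omega> \<and> product_irregular G \<omega>"
proof -
  note disj = three_cliques_disjoint[OF assms(1)]
  have B: "finite B" using disj(4) pair_finite_verts by (metis finite_Un)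
  have notin: "a \<notin> B" "a \<notin> C" "b \<notin> A" "b \<notin> C" "b' \<notin> A" "b' \<notin> C" "c \<notin> A" "c \<notin> B"
    using disj assms(2-5) by auto
  then have neq: "{a, b} \<noteq> {c, b'}" using assms(2,5) by (auto simp: doubleton_eq_iff)
  show ?thesis
  proof (rule ex_labelling_if_three_blocks[of A B C "{{a, b}, {c, b'}}" SA SB SC])
    show "block A (\<lambda>v. card {e \<in> {{a, b}, {c, b'}}. v \<in> e}) SA"
      by (rule block_at_one[OF assms(11,8,2)], unfold card_pairs_at(2)[OF neq])
        (use assms(2-5) notin in auto)
    show "block C (\<lambda>v. card {e \<in> {{a, b}, {c, b'}}. v \<in> e}) SC"
      by (rule block_at_one[OF assms(12,10,5)], unfold card_pairs_at(2)[OF neq])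
        (use assms(2-5) notin in auto)
    show "block B (\<lambda>v. card {e \<in> {{a, b}, {c, b'}}. v \<in> e}) SB"
    proof (cases "b = b'")
      case True
      show ?thesis
        by (rule block_at_one[OF assms(14,9,3)], unfold card_pairs_at(2)[OF neq])
          (use True assms(2-5) notin in auto)
    next
      case False
      show ?thesis
        by (rule block_at_two[OF assms(13) B assms(3,4) False], unfold card_pairs_at(2)[OF neq])
          (use False assms(2-5) notin in auto)
    qed
  qed (use assms notin doubleton_in_edges in auto)
qed

section \<open>Cliques of sizes 4 and 5\<close>

text \<open>
  Every labelling of the complete graph on four vertices with distinct product degrees attains the
  point \<open>(1, 1)\<close>, so two cliques of size 4 force the use of an edge between cliques. The
  matrices were found by exhaustive search.
\<close>

lemma realises_small_4: "realises 4 (\<lambda>_. 0)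
    {(0, 1), (1, 0), (1, 1), (2, 0)}"
  by (rule realises_table[of _ _
      "[[1, 1, 1, 3],
      [1, 1, 2, 1],
      [1, 2, 1, 2],
      [3, 1, 2, 1]]"
      "[(0, 1), (1, 0), (2, 0), (1, 1)]"])
    (simp_all add: table_def pow23_def upt_rec)

lemma realises_small_5: "realises 5 (\<lambda>_. 0)
    {(0, 0), (0, 1), (1, 0), (1, 1), (2, 0)}"
  by (rule realises_table[of _ _
      "[[1, 1, 1, 1, 1],
      [1, 1, 1, 1, 3],
      [1, 1, 1, 2, 1],
      [1, 1, 2, 1, 2],
      [1, 3, 1, 2, 1]]"
      "[(0, 0), (0, 1), (1, 0), (2, 0), (1, 1)]"])
    (simp_all add: table_def pow23_def upt_rec)

text \<open>For the middle clique when it has size 5. The points also avoid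
  \<open>near_antidiagonal n\<close> for \<open>n \<ge> 6\<close>: on the line
  \<open>x + y = 4\<close>, which matters for \<open>n = 6\<close>, that region only has points with
  \<open>x \<ge> 2\<close>.\<close>

lemma realises_middle_5: "realises 5 (\<lambda>_. 0)
    {(0, 2), (0, 3), (0, 4), (1, 2), (1, 3)}"
  by (rule realises_table[of _ _
      "[[1, 1, 1, 3, 3],
      [1, 1, 3, 2, 3],
      [1, 3, 1, 3, 3],
      [3, 2, 3, 1, 3],
      [3, 3, 3, 3, 1]]"
      "[(0, 2), (1, 2), (0, 3), (1, 3), (0, 4)]"])
    (simp_all add: table_def pow23_def upt_rec)

lemma realises_large_5: "realises 5 (\<lambda>_. 0)
    {(2, 1), (2, 2), (3, 0), (3, 1), (4, 0)}"
  by (rule realises_table[of _ _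
      "[[1, 1, 2, 2, 2],
      [1, 1, 2, 2, 3],
      [2, 2, 1, 2, 2],
      [2, 2, 2, 1, 3],
      [2, 3, 2, 3, 1]]"
      "[(3, 0), (2, 1), (4, 0), (3, 1), (2, 2)]"])
    (simp_all add: table_def pow23_def upt_rec)

text \<open>For sizes 4, 4 and at least 6, with an edge between the small cliques. Here and in
  \<open>realises_smalls_joined_snd\<close> all points have \<open>x + y \<le> 3\<close>, below the
  region of the large clique. The edge moves vertex 0 of the second clique off
  \<open>(1, 1)\<close>, which the first one uses.\<close>

lemma realises_smalls_joined_fst: "realises 4 (\<lambda>i. if i = 0 then 1 else 0)
    {(0, 0), (0, 1), (1, 1), (2, 0)}"
  by (rule realises_table[of _ _
      "[[1, 1, 1, 2],
      [1, 1, 1, 1],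
      [1, 1, 1, 3],
      [2, 1, 3, 1]]"
      "[(2, 0), (0, 0), (0, 1), (1, 1)]"])
    (simp_all add: table_def pow23_def upt_rec)

lemma realises_smalls_joined_snd: "realises 4 (\<lambda>i. if i = 0 then 1 else 0)
    {(0, 2), (0, 3), (1, 2), (2, 1)}"
  by (rule realises_table[of _ _
      "[[1, 1, 2, 3],
      [1, 1, 3, 3],
      [2, 3, 1, 3],
      [3, 3, 3, 1]]"
      "[(2, 1), (0, 2), (1, 2), (0, 3)]"])
    (simp_all add: table_def pow23_def upt_rec)

text \<open>Vertices 0 and 1 have the same product within the clique; the edge to the large clique
  separates them. This leaves \<open>(1, 1)\<close> to the other clique of size 4.\<close>

lemma realises_small_large_joined_fst: "realises 4 (\<lambda>i. if i = 0 then 1 else 0)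
    {(0, 1), (1, 0), (2, 0), (2, 1)}"
  by (rule realises_table[of _ _
      "[[1, 1, 1, 2],
      [1, 1, 1, 2],
      [1, 1, 1, 3],
      [2, 2, 3, 1]]"
      "[(2, 0), (1, 0), (0, 1), (2, 1)]"])
    (simp_all add: table_def pow23_def upt_rec)

lemma realises_small_large_joined_other: "realises 4 (\<lambda>_. 0)
    {(0, 2), (0, 3), (1, 1), (1, 2)}"
  by (rule realises_table[of _ _
      "[[1, 1, 2, 3],
      [1, 1, 3, 3],
      [2, 3, 1, 3],
      [3, 3, 3, 1]]"
      "[(1, 1), (0, 2), (1, 2), (0, 3)]"])
    (simp_all add: table_def pow23_def upt_rec)

text \<open>For sizes 4, 4 and 5, with the edge between the cliques of size 4. The third clique is
  too small for \<open>near_antidiagonal\<close> and has a table of its own.\<close>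

lemma realises_smalls_joined_5_fst: "realises 4 (\<lambda>i. if i = 0 then 1 else 0)
    {(0, 1), (1, 0), (1, 1), (3, 0)}"
  by (rule realises_table[of _ _
      "[[1, 1, 2, 2],
      [1, 1, 1, 3],
      [2, 1, 1, 1],
      [2, 3, 1, 1]]"
      "[(3, 0), (0, 1), (1, 0), (1, 1)]"])
    (simp_all add: table_def pow23_def upt_rec)

lemma realises_smalls_joined_5_snd: "realises 4 (\<lambda>i. if i = 0 then 1 else 0)
    {(0, 2), (2, 0), (2, 1), (3, 1)}"
  by (rule realises_table[of _ _
      "[[1, 2, 2, 3],
      [2, 1, 2, 1],
      [2, 2, 1, 3],
      [3, 1, 3, 1]]"
      "[(3, 1), (2, 0), (2, 1), (0, 2)]"])
    (simp_all add: table_def pow23_def upt_rec)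

lemma realises_smalls_joined_5_large: "realises 5 (\<lambda>_. 0)
    {(0, 3), (0, 4), (1, 2), (1, 3), (2, 2)}"
  by (rule realises_table[of _ _
      "[[1, 1, 2, 3, 3],
      [1, 1, 3, 3, 3],
      [2, 3, 1, 2, 3],
      [3, 3, 2, 1, 3],
      [3, 3, 3, 3, 1]]"
      "[(1, 2), (0, 3), (2, 2), (1, 3), (0, 4)]"])
    (simp_all add: table_def pow23_def upt_rec)

text \<open>Joined to \<open>realises_small_large_joined_fst\<close>. The edge separates vertices 0
  and 3, which both have product 36 within the clique.\<close>

lemma realises_small_large_joined_5_large: "realises 5 (\<lambda>i. if i = 0 then 1 else 0)
    {(1, 3), (2, 2), (3, 1), (3, 2), (4, 0)}"
  by (rule realises_table[of _ _
      "[[1, 2, 2, 3, 3],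
      [2, 1, 2, 2, 2],
      [2, 2, 1, 2, 3],
      [3, 2, 2, 1, 3],
      [3, 2, 3, 3, 1]]"
      "[(3, 2), (4, 0), (3, 1), (2, 2), (1, 3)]"])
    (simp_all add: table_def pow23_def upt_rec)

lemma realises_path_fst: "realises 4 (\<lambda>i. if i = 0 then 1 else 0)
    {(0, 0), (0, 1), (0, 2), (1, 1)}"
  by (rule realises_table[of _ _
      "[[1, 1, 1, 3],
      [1, 1, 1, 1],
      [1, 1, 1, 3],
      [3, 1, 3, 1]]"
      "[(1, 1), (0, 0), (0, 1), (0, 2)]"])
    (simp_all add: table_def pow23_def upt_rec)

lemma realises_path_last: "realises 4 (\<lambda>i. if i = 0 then 1 else 0)
    {(0, 3), (1, 2), (2, 1), (2, 2)}"
  by (rule realises_table[of _ _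
      "[[1, 2, 3, 3],
      [2, 1, 2, 3],
      [3, 2, 1, 3],
      [3, 3, 3, 1]]"
      "[(2, 2), (2, 1), (1, 2), (0, 3)]"])
    (simp_all add: table_def pow23_def upt_rec)

text \<open>The middle clique only uses labels 1 and 2, so its points lie on the x-axis.
  \<open>realises_path_middle_same\<close> attains the same four points when both edges meet in one
  vertex.\<close>

lemma realises_path_middle: "realises 4 (\<lambda>i. if i < 2 then 1 else 0)
    {(1, 0), (2, 0), (3, 0), (4, 0)}"
  by (rule realises_table[of _ _
      "[[1, 2, 1, 2],
      [2, 1, 2, 2],
      [1, 2, 1, 1],
      [2, 2, 1, 1]]"
      "[(3, 0), (4, 0), (1, 0), (2, 0)]"])
    (simp_all add: table_def pow23_def upt_rec)

lemma realises_path_middle_same: "realises 4 (\<lambda>i. if i = 0 then 2 else 0)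
    {(1, 0), (2, 0), (3, 0), (4, 0)}"
  by (rule realises_table[of _ _
      "[[1, 1, 2, 2],
      [1, 1, 1, 2],
      [2, 1, 1, 2],
      [2, 2, 2, 1]]"
      "[(4, 0), (1, 0), (2, 0), (3, 0)]"])
    (simp_all add: table_def pow23_def upt_rec)

section \<open>Product irregularity strength\<close>

text \<open>Otherwise \<open>A\<close> would be closed under walking along arcs, and
  \<open>b\<close> could not be reached from \<open>a\<close>.\<close>

lemma (in pair_graph) ex_arc_leaving:
  assumes "connected G" "a \<in> A" "a \<in> pverts G" "b \<in> pverts G - A"
  shows "\<exists>u\<in>A. \<exists>v\<in>pverts G - A. (u, v) \<in> parcs G"
proof (rule ccontr)
  assume leaving: "\<not> ?thesis"
  have closed: "v \<in> A" if "u \<in> A" "(u, v) \<in> parcs G" for u v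
    using that parcsD leaving by blast
  \<comment> \<open>Connectedness refers to the symmetric closure, which adds no arcs to a symmetric
    digraph.\<close>
  have "(a, b) \<in> rtrancl_on (pverts G) (parcs (mk_symmetric G))"
    using assms by (auto simp: connected_def strongly_connected_def reachable_def mk_symmetric_def)
  then have "b \<in> A"
  proof (induction rule: rtrancl_on_induct)
    case (step u v)
    then show ?case using closed parcsD by (auto simp: mk_symmetric_def)
  qed (rule assms(2))
  then show False using assms(4) by simp
qed

text \<open>Product degrees are powers of 2 whose exponents are the degrees in the graph of edges
  labelled 2. If distinct, these fill all of \<open>{..<card (pverts G)}\<close>; but a vertex of
  maximal degree would be adjacent to one of degree 0.\<close>

lemma (in pair_graph) not_product_irregular_2:
  assumes "2 \<le> card (pverts G)" "edge_labelling G 2 \<omega>"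
  shows "\<not> product_irregular G \<omega>"
proof
  assume irr: "product_irregular G \<omega>"
  define N where "N v = {u \<in> pverts G. {v, u} \<in> edges G \<and> \<omega> {v, u} = 2}" for v
  have "product_degree G \<omega> v = 2 ^ card (N v)" for v
  proof -
    have "\<omega> {v, u} = (if \<omega> {v, u} = 2 then 2 else 1)" if "{v, u} \<in> edges G" for u
      using assms(2) that unfolding edge_labelling_def by fastforce
    then have "product_degree G \<omega> v = (\<Prod>u \<in> {u \<in> pverts G. {v, u} \<in> edges G}. if \<omega> {v, u} = 2 then 2 else 1)"
      unfolding product_degree_eq by (intro prod.cong) auto
    also have "\<dots> = (\<Prod>u \<in> {u \<in> {u \<in> pverts G. {v, u} \<in> edges G}. \<omega> {v, u} = 2}. 2)"
      by (rule prod.inter_filter[symmetric]) (simp add: pair_finite_verts)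
    finally show ?thesis by (simp add: N_def conj_assoc)
  qed
  then have inj: "inj_on (\<lambda>v. card (N v)) (pverts G)"
    using irr unfolding product_irregular_def inj_on_def by metis
  have N: "N v \<subseteq> pverts G - {v}" for v
    using parcsD by (auto simp: N_def doubleton_in_edges)
  have fin: "finite (pverts G)" by (rule pair_finite_verts)
  have "card (N v) < card (pverts G)" if "v \<in> pverts G" for v
    using N[of v] that fin by (intro psubset_card_mono) auto
  then have "(\<lambda>v. card (N v)) ` pverts G \<subseteq> {..<card (pverts G)}" by auto
  then have img: "(\<lambda>v. card (N v)) ` pverts G = {..<card (pverts G)}"
    using inj by (intro card_subset_eq) (auto simp: card_image)
  have "0 \<in> (\<lambda>v. card (N v)) ` pverts G" "card (pverts G) - 1 \<in> (\<lambda>v. card (N v)) ` pverts G"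
    unfolding img using assms(1) by auto
  then obtain v w where v: "v \<in> pverts G" "card (N v) = 0"
    and w: "w \<in> pverts G" "card (N w) = card (pverts G) - 1"
    by (auto simp del: card_0_eq card_eq_0_iff)
  have "N w = pverts G - {w}"
    using N[of w] w fin by (intro card_subset_eq) auto
  moreover have "v \<noteq> w" using v w assms(1) by auto
  ultimately have "v \<in> N w" using v by auto
  then have "w \<in> N v" using w by (auto simp: N_def insert_commute)
  then show False using v(2) fin by (auto simp: N_def)
qed

section \<open>Case analysis on the clique sizes\<close>

lemma (in pair_graph) ex_labelling_4_4_4:
  assumes "three_cliques G A B C" "card A = 4" "card B = 4" "card C = 4"
    and "(a, b) \<in> parcs G" "(c, b') \<in> parcs G" "a \<in> A" "b \<in> B" "b' \<in> B" "c \<in> C"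
  shows "\<exists>\<omega>. edge_labelling G 3 \<omega> \<and> product_irregular G \<omega>"
  by (rule ex_labelling_two_edges[OF assms(1,7-10,5,6)], unfold assms(2-4),
      simp, simp, simp, rule realises_path_fst, rule realises_path_last,
      rule realises_path_middle, rule realises_path_middle_same)
    auto

lemma (in pair_graph) ex_labelling_4_4_n:
  assumes "three_cliques G A B C" "card A = 4" "card B = 4" "5 \<le> card C"
    and "a \<in> A" "u \<in> pverts G - A" "(a, u) \<in> parcs G"
  shows "\<exists>\<omega>. edge_labelling G 3 \<omega> \<and> product_irregular G \<omega>"
proof -
  have C: "card C = 5 \<or> 6 \<le> card C" using assms(4) by auto
  have "u \<in> B \<or> u \<in> C" using assms(6) three_cliques_disjoint(4)[OF assms(1)] by auto
  then show ?thesis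
  proof
    assume u: "u \<in> B"
    note edge = ex_labelling_one_edge[OF assms(1,5) u assms(7)]
    from C show ?thesis
    proof
      assume C5: "card C = 5"
      show ?thesis
        by (rule edge, unfold assms(2,3) C5, simp, simp,
            rule realises_smalls_joined_5_fst, rule realises_smalls_joined_5_snd,
            rule realises_smalls_joined_5_large) auto
    next
      assume C6: "6 \<le> card C"
      show ?thesis
        by (rule edge[of _ _ "near_antidiagonal (card C)"], unfold assms(2,3), simp, simp,
            rule realises_smalls_joined_fst, rule realises_smalls_joined_snd, rule realises_near_antidiagonal[OF C6])
          (use C6 in \<open>auto simp: near_antidiagonal_def\<close>)
    qed
  next
    assume u: "u \<in> C"
    \<comment> \<open>\<open>B\<close> and \<open>C\<close> are exchanged, since the edge must join
      the first two cliques of the triple.\<close>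
    note edge = ex_labelling_one_edge[OF three_cliques_commute(2)[OF assms(1)] assms(5) u assms(7)]
    from C show ?thesis
    proof
      assume C5: "card C = 5"
      show ?thesis
        by (rule edge, unfold assms(2,3) C5, simp, simp,
            rule realises_small_large_joined_fst, rule realises_small_large_joined_5_large,
            rule realises_small_large_joined_other) auto
    next
      assume C6: "6 \<le> card C"
      show ?thesis
        by (rule edge[of _ "near_antidiagonal (card C)"], unfold assms(2,3), simp, use C6 in simp,
            rule realises_small_large_joined_fst, rule realises_near_antidiagonal[OF C6], simp,
            rule realises_small_large_joined_other)
          (use C6 in \<open>auto simp: near_antidiagonal_def\<close>)
    qed
  qed
qed

lemma (in pair_graph) ex_labelling_small_5_n:
  assumes "three_cliques G A B C" "4 \<le> card A" "card A \<le> 5" "card B = 5" "5 \<le> card C"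
  shows "\<exists>\<omega>. edge_labelling G 3 \<omega> \<and> product_irregular G \<omega>"
proof -
  let ?SA = "{(0, 0), (0, 1), (1, 0), (1, 1), (2, 0)}"
  let ?SC = "if card C = 5 then {(2, 1), (2, 2), (3, 0), (3, 1), (4, 0)} else near_antidiagonal (card C)"
  have "card A = 4 \<or> card A = 5" using assms(2,3) by auto
  then have A: "realises (card A) (\<lambda>_. 0) ?SA"
    using realises_small_5 realises_mono[OF realises_small_4, of ?SA] by auto
  have C: "realises (card C) (\<lambda>_. 0) ?SC"
    using realises_large_5 realises_near_antidiagonal[of "card C"] assms(5) by auto
  show ?thesis
    by (rule ex_labelling_no_edge[OF assms(1) A _ C], unfold assms(4), rule realises_middle_5)
      (use assms(5) in \<open>auto simp: near_antidiagonal_def\<close>)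
qed

lemma (in pair_graph) ex_labelling_sorted:
  assumes "three_cliques G A B C" "connected G" "4 \<le> card A" "card A \<le> card B" "card B \<le> card C"
  shows "\<exists>\<omega>. edge_labelling G 3 \<omega> \<and> product_irregular G \<omega>"
proof -
  note disj = three_cliques_disjoint[OF assms(1)]
  have ne: "A \<noteq> {}" "B \<noteq> {}" "C \<noteq> {}" using assms(3-5) by auto
  have leave: "\<exists>u\<in>K. \<exists>v\<in>pverts G - K. (u, v) \<in> parcs G"
    if K: "K \<noteq> {}" "L \<noteq> {}" "K \<inter> L = {}" "K \<union> L \<subseteq> pverts G" for K L
  proof -
    obtain a b where "a \<in> K" "b \<in> L" using K(1,2) by blast
    then show ?thesis using ex_arc_leaving[OF assms(2), of a K b] K(3,4) by blast
  qed
  have sub: "A \<union> B \<subseteq> pverts G" "B \<union> A \<subseteq> pverts G" "C \<union> A \<subseteq> pverts G"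
    unfolding disj(4)[symmetric] by auto
  have outside: "pverts G - A = B \<union> C" "pverts G - B = A \<union> C" "pverts G - C = A \<union> B"
    using disj(1-3) unfolding disj(4)[symmetric] by auto
  note leave = leave[OF ne(1,2) disj(1) sub(1)] leave[OF ne(2,1) _ sub(2)] leave[OF ne(3,1) _ sub(3)]
  have leaveA: "\<exists>u\<in>A. \<exists>v\<in>B \<union> C. (u, v) \<in> parcs G"
    and leaveB: "\<exists>u\<in>B. \<exists>v\<in>A \<union> C. (u, v) \<in> parcs G"
    and leaveC: "\<exists>u\<in>C. \<exists>v\<in>A \<union> B. (u, v) \<in> parcs G"
    using leave disj(1,2) by (simp_all add: outside Int_commute)
  consider "card B = 4" "card C = 4" | "card B = 4" "5 \<le> card C" | "card B = 5" | "6 \<le> card B"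
    using assms(3-5) by linarith
  then show ?thesis
  proof cases
    case 1
    then have card: "card A = 4" "card B = 4" "card C = 4" using assms(3-5) by auto
    note perm = assms(1) three_cliques_commute(1)[OF assms(1)] three_cliques_commute(2)[OF assms(1)]
    obtain a u where a: "a \<in> A" "(a, u) \<in> parcs G" "u \<in> B \<or> u \<in> C" using leaveA by blast
    obtain b v where b: "b \<in> B" "(b, v) \<in> parcs G" "v \<in> A \<or> v \<in> C" using leaveB by blast
    obtain c w where c: "c \<in> C" "(c, w) \<in> parcs G" "w \<in> A \<or> w \<in> B" using leaveC by blast
    have rev: "(u, a) \<in> parcs G" using parcsD[OF a(2)] by simp
    show ?thesis
    \<comment> \<open>The clique that contains neither \<open>a\<close> nor \<open>u\<close> has an
      edge to one of the other two; the clique where that edge ends becomes the middle of the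
      path.\<close>
    proof (cases "u \<in> B")
      case True
      then show ?thesis
        using ex_labelling_4_4_4[OF perm(1) card(1,2,3) a(2) c(2)]
          ex_labelling_4_4_4[OF perm(2) card(2,1,3) rev c(2)] a c by blast
    next
      case False
      then have "u \<in> C" using a(3) by blast
      then show ?thesis
        using ex_labelling_4_4_4[OF perm(3) card(1,3,2) a(2) b(2)]
          ex_labelling_4_4_4[OF three_cliques_commute(1)[OF perm(3)] card(3,1,2) rev b(2)] a b by blast
    qed
  next
    case 2
    then have "card A = 4" using assms(3,4) by simp
    then show ?thesis using ex_labelling_4_4_n[OF assms(1) _ 2] leaveA outside(1) by blast
  next
    case 3
    then show ?thesis using ex_labelling_small_5_n[OF assms(1)] assms(3-5) by simp
  next
    case 4
    then have "6 \<le> card C" using assms(5) by simp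
    show ?thesis
      by (rule ex_labelling_no_edge[OF assms(1) realises_near_x_axis[OF assms(3)]
            realises_near_y_axis[OF 4] realises_near_antidiagonal[OF \<open>6 \<le> card C\<close>]])
        (use 4 assms in \<open>auto simp: near_x_axis_def near_y_axis_def near_antidiagonal_def\<close>)
  qed
qed

theorem corollary4p14:
  fixes G :: "'a pair_pre_digraph"
  assumes "nonisolated_graph G"
    and "connected G"
    and "\<exists>P. partition_on (pverts G) P \<and> card P = 3 \<and> (\<forall>C \<in> P. clique G C \<and> 4 \<le> card C)"
  shows "product_irregularity_strength G = 3"
proof -
  interpret nonisolated_graph G by (rule assms(1))
  obtain P where P: "partition_on (pverts G) P" "card P = 3" "\<And>C. C \<in> P \<Longrightarrow> clique G C \<and> 4 \<le> card C"
    using assms(3) by blast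
  obtain A B C where "P = {A, B, C}" "A \<noteq> B" "A \<noteq> C" "B \<noteq> C"
    using P(2) card_3_iff by metis
  then have ABC: "three_cliques G A B C" "4 \<le> card A" "4 \<le> card B" "4 \<le> card C"
    using P by (auto simp: three_cliques_def)
  \<comment> \<open>Exchanges of neighbouring cliques in the triple suffice to sort them by
    size.\<close>
  obtain A' B' C' where "three_cliques G A' B' C'" "4 \<le> card A'" "card A' \<le> card B'" "card B' \<le> card C'"
    using ABC three_cliques_commute by (metis nle_le)
  then obtain \<omega> where \<omega>: "edge_labelling G 3 \<omega>" "product_irregular G \<omega>"
    using ex_labelling_sorted assms(2) by blast
  have "card A \<le> card (pverts G)"
    using three_cliques_disjoint(4)[OF ABC(1)] pair_finite_verts by (intro card_mono) auto
  then have V: "2 \<le> card (pverts G)" using ABC(2) by simp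
  show ?thesis
    unfolding product_irregularity_strength_def
  proof (rule Least_equality)
    show "0 < (3::nat) \<and> (\<exists>\<omega>. edge_labelling G 3 \<omega> \<and> product_irregular G \<omega>)" using \<omega> by auto
  next
    fix s :: nat assume "0 < s \<and> (\<exists>\<omega>. edge_labelling G s \<omega> \<and> product_irregular G \<omega>)"
    then obtain \<omega> where "edge_labelling G s \<omega>" "product_irregular G \<omega>" by blast
    \<comment> \<open>A smaller range of labels is contained in \<open>{1..2}\<close>, so excluding
      2 excludes 1 as well.\<close>
    moreover have "edge_labelling G 2 \<omega>" if "s \<le> 2"
      using calculation(1) that by (fastforce simp: edge_labelling_def)
    ultimately show "3 \<le> s" using not_product_irregular_2[OF V] by fastforce
  qed
qed

end
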